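(* Let $\Sigma$ be a finite alphabet and let $l\ge1$ and $n\ge 2l$ be integers. For a family $(p(u))_{u\in\Sigma^{n+1}}$ of complex numbers, set $p(v):=\sum_{a\in\Sigma}p(va)$ for $v\in\Sigma^n$. Then $$(p(u))_{u\in\Sigma^{n+1}}\in\mathrm{image}\,\mathbf{f}_{n+1,l}\iff (p(av))_{v\in\Sigma^n}\in\mathrm{image}\,\mathbf{f}_{n,l}\ \text{ for all } a\in\Sigma\ \text{ and }\ (p(v))_{v\in\Sigma^n}\in\mathrm{image}\,\mathbf{f}_{n,l}.$$
   Context: $\Sigma^n$ is the set of strings of length $n$ over $\Sigma$; concatenation is written by juxtaposition. The unconstrained hidden Markov model with $l$ hidden states on strings of length $n$ is the polynomial map $$\mathbf{f}_{n,l}:\mathbb{C}^{l(l-1)+l(|\Sigma|-1)+l}\to\mathbb{C}^{|\Sigma|^n},\qquad (A,E,x)\mapsto\big((1,\dots,1)\,T_{a_n}\cdots T_{a_1}\,x\big)_{v=a_1\dots a_n\in\Sigma^n},$$ where the parameters are a matrix $A\in\mathbb{C}^{l\times l}$ each of whose rows sums to $1$ (transition matrix), a matrix $E=(E_{ia})_{1\le i\le l,\,a\in\Sigma}$ with complex entries each of whose rows sums to $1$ (emission matrix), and a vector $x\in\mathbb{C}^l$ (initial vector, entries not required to sum to $1$), and where $T_a:=A^TO_a$ with $O_a:=\mathrm{diag}(E_{ia},\,i=1,\dots,l)$. *)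

theory Defs
  imports "HOL-Library.FuncSet" "Jordan_Normal_Form.Matrix"
begin

definition words :: "'a set \<Rightarrow> nat \<Rightarrow> 'a list set" where
  "words \<Sigma> n = {w. set w \<subseteq> \<Sigma> \<and> length w = n}"

text \<open>
  The parameters are triples \<open>(A, E, x)\<close>; the hidden states are numbered \<open>0, \<dots>, l - 1\<close>,
  and only the values \<open>E i a\<close> with \<open>i < l\<close> and \<open>a \<in> \<Sigma>\<close> are relevant.
  The entries of \<open>x\<close> are not required to sum to 1.
\<close>

definition hmm_params ::
    "'a set \<Rightarrow> nat \<Rightarrow> (complex mat \<times> (nat \<Rightarrow> 'a \<Rightarrow> complex) \<times> complex vec) set" where
  "hmm_params \<Sigma> l = {(A, E, x).
     A \<in> carrier_mat l l \<and> (\<forall>i<l. (\<Sum>j<l. A $$ (i, j)) = 1) \<and>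
     (\<forall>i<l. (\<Sum>a\<in>\<Sigma>. E i a) = 1) \<and>
     x \<in> carrier_vec l}"

definition hmm_op ::
    "nat \<Rightarrow> complex mat \<Rightarrow> (nat \<Rightarrow> 'a \<Rightarrow> complex) \<Rightarrow> 'a \<Rightarrow> complex mat" where
  "hmm_op l A E a = transpose_mat A * mat_diag l (\<lambda>i. E i a)"

text \<open>
  For \<open>v = [a\<^sub>1, \<dots>, a\<^sub>n]\<close>, the \<open>fold\<close> below applies the matrix of \<open>a\<^sub>1\<close> first and that of
  \<open>a\<^sub>n\<close> last. The families indexed by the words of length \<open>n\<close> are represented by
  functions that are \<open>undefined\<close> on all other lists.
\<close>

definition hmm_map ::
    "'a set \<Rightarrow> nat \<Rightarrow> nat \<Rightarrow> complex mat \<times> (nat \<Rightarrow> 'a \<Rightarrow> complex) \<times> complex vec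
      \<Rightarrow> ('a list \<Rightarrow> complex)" where
  "hmm_map \<Sigma> n l = (\<lambda>(A, E, x). \<lambda>v\<in>words \<Sigma> n.
     scalar_prod (vec l (\<lambda>_. 1)) (fold (\<lambda>a y. hmm_op l A E a *\<^sub>v y) v x))"

definition marginal :: "'a set \<Rightarrow> ('a list \<Rightarrow> complex) \<Rightarrow> 'a list \<Rightarrow> complex" where
  "marginal \<Sigma> p v = (\<Sum>a\<in>\<Sigma>. p (v @ [a]))"

end

theory Submission
  imports Defs "HOL-Library.Function_Algebras"
begin

text \<open>
  A hidden Markov model with \<open>l\<close> states yields a series on words whose shifts span a space of
  dimension at most \<open>l\<close>. Hence the difference of two such series has at most \<open>2 * l\<close> independent
  shifts, and it vanishes identically once it vanishes on the words of length less than \<open>2 * l\<close>.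
  Let \<open>(A, E, x)\<close> represent the marginal of \<open>p\<close>. For each letter \<open>a\<close>, the given model of
  \<open>p (a # _)\<close> and the model \<open>(A, E, T\<^sub>a x)\<close> agree on the words of length \<open>n - 1 \<ge> 2 * l - 1\<close>,
  and by summing out last letters also on the shorter ones. So they agree on all words, and
  \<open>(A, E, x)\<close> represents \<open>p\<close>.
\<close>

section \<open>Series with finitely many independent shifts\<close>

global_interpretation series: vector_space "\<lambda>(c::complex) (f::'a list \<Rightarrow> complex) w. c * f w"
  by standard (auto simp: fun_eq_iff algebra_simps)

text \<open>The series \<open>shift u f\<close> are the rows of the Hankel matrix of
  \<open>f\<close>, whose entry at \<open>(u, w)\<close> is \<open>f (u @ w)\<close>.\<close>

definition shift :: "'a list \<Rightarrow> ('a list \<Rightarrow> complex) \<Rightarrow> 'a list \<Rightarrow> complex" where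
  "shift u f w = f (u @ w)"

lemma shift_in_span:
  fixes S :: "('a list \<Rightarrow> complex) set"
  assumes "g \<in> series.span S"
    and "\<And>g. g \<in> S \<Longrightarrow> shift u g \<in> series.span T"
  shows "shift u g \<in> series.span T"
  using assms(1)
proof (induction rule: series.span_induct_alt)
  case base
  have "shift u (0 :: 'a list \<Rightarrow> complex) = 0"
    by (simp add: shift_def fun_eq_iff)
  then show ?case
    by (simp only: series.span_zero)
next
  case (step c g h)
  have "shift u ((\<lambda>w. c * g w) + h) = (\<lambda>w. c * shift u g w) + shift u h"
    by (simp add: shift_def fun_eq_iff)
  with step assms(2) show ?case
    by (simp only: series.span_add series.span_scale)
qed

lemma span_vanishing_at:
  fixes S :: "('a list \<Rightarrow> complex) set"
  assumes "g \<in> series.span S" and "\<And>g. g \<in> S \<Longrightarrow> g w = 0"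
  shows "g w = 0"
  using assms(1) by (induction rule: series.span_induct_alt) (use assms(2) in auto)

text \<open>If every length up to \<open>d\<close> contributed a shift outside the span of the
  shorter ones, these \<open>d + 1\<close> shifts would be independent inside a space with
  \<open>d\<close> generators. The case \<open>k = 0\<close> means \<open>f = 0\<close>.\<close>

lemma shifts_stabilize:
  fixes f :: "'a list \<Rightarrow> complex"
  assumes U: "finite U" "card U \<le> d"
    and shifts: "\<And>u. set u \<subseteq> \<Sigma> \<Longrightarrow> shift u f \<in> series.span U"
  shows "\<exists>k\<le>d. \<forall>u. set u \<subseteq> \<Sigma> \<and> length u = k \<longrightarrow>
    shift u f \<in> series.span {shift v f |v. set v \<subseteq> \<Sigma> \<and> length v < k}"
proof (rule ccontr)
  define S where "S k = {shift v f |v. set v \<subseteq> \<Sigma> \<and> length v < k}" for k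
  assume "\<not> ?thesis"
  then have new: "\<exists>u. set u \<subseteq> \<Sigma> \<and> length u = k \<and> shift u f \<notin> series.span (S k)"
    if "k \<le> d" for k
    using that unfolding S_def by blast
  have "\<exists>B \<subseteq> S k. series.independent B \<and> finite B \<and> card B = k" if "k \<le> Suc d" for k
    using that
  proof (induction k)
    case 0
    show ?case using series.independent_empty by (auto intro!: exI[of _ "{}"])
  next
    case (Suc k)
    then obtain B where B: "B \<subseteq> S k" "series.independent B" "finite B" "card B = k"
      by auto
    obtain u where u: "set u \<subseteq> \<Sigma>" "length u = k" "shift u f \<notin> series.span (S k)"
      using new Suc.prems by force
    then have notin: "shift u f \<notin> series.span B"
      using series.span_mono[OF B(1)] by blast
    have "insert (shift u f) B \<subseteq> S (Suc k)"
      using B(1) u(1,2) unfolding S_def by (auto; force)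
    moreover have "card (insert (shift u f) B) = Suc k"
      using B notin series.span_base by (subst card_insert_disjoint) auto
    moreover have "series.independent (insert (shift u f) B)"
      using B notin by (simp add: series.independent_insertI)
    ultimately show ?case
      using B(3) by blast
  qed
  then obtain B where B: "B \<subseteq> S (Suc d)" "series.independent B" "card B = Suc d"
    by blast
  have "B \<subseteq> series.span U"
    using B(1) shifts unfolding S_def by blast
  then have "card B \<le> card U"
    using series.independent_span_bound[OF U(1) B(2)] by blast
  then show False
    using B(3) U(2) by simp
qed

text \<open>Once the shifts by words of length \<open>k\<close> lie in the span of the shorter ones,
  that span is closed under appending a letter and so contains all shifts.\<close>

lemma series_zero_if_zero_on_short_words:
  fixes f :: "'a list \<Rightarrow> complex"
  assumes U: "finite U" "card U \<le> d"
    and shifts: "\<And>u. set u \<subseteq> \<Sigma> \<Longrightarrow> shift u f \<in> series.span U"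
    and short: "\<And>w. set w \<subseteq> \<Sigma> \<Longrightarrow> length w < d \<Longrightarrow> f w = 0"
    and w: "set w \<subseteq> \<Sigma>"
  shows "f w = 0"
proof -
  define S where "S k = {shift v f |v. set v \<subseteq> \<Sigma> \<and> length v < k}" for k
  obtain k where k: "k \<le> d"
    "\<And>u. set u \<subseteq> \<Sigma> \<Longrightarrow> length u = k \<Longrightarrow> shift u f \<in> series.span (S k)"
    using shifts_stabilize[OF U shifts] unfolding S_def by blast
  have le: "shift u f \<in> series.span (S k)" if "set u \<subseteq> \<Sigma>" "length u \<le> k" for u
  proof (cases "length u = k")
    case False
    then have "shift u f \<in> S k"
      using that unfolding S_def by auto
    then show ?thesis by (rule series.span_base)
  qed (use k that in auto)
  have "shift w f \<in> series.span (S k)"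
    using w
  proof (induction w rule: rev_induct)
    case Nil
    show ?case by (rule le) auto
  next
    case (snoc a u)
    \<comment> \<open>A further shift by \<open>a\<close> lengthens the words of the generators to
      at most \<open>k\<close>, which \<open>le\<close> covers.\<close>
    have "shift [a] (shift u f) \<in> series.span (S k)"
    proof (rule shift_in_span)
      show "shift u f \<in> series.span (S k)"
        using snoc by simp
      fix g assume "g \<in> S k"
      then obtain v where v: "g = shift v f" "set v \<subseteq> \<Sigma>" "length v < k"
        unfolding S_def by auto
      have "shift [a] g = shift (v @ [a]) f"
        by (simp add: v(1) shift_def fun_eq_iff)
      also have "\<dots> \<in> series.span (S k)"
        by (rule le) (use v snoc.prems in auto)
      finally show "shift [a] g \<in> series.span (S k)" .
    qed
    moreover have "shift [a] (shift u f) = shift (u @ [a]) f"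
      by (simp add: shift_def fun_eq_iff)
    ultimately show ?case by simp
  qed
  \<comment> \<open>At the empty word a generator \<open>shift v f\<close> takes the value
    \<open>f v\<close>, which is 0 because \<open>length v < k \<le> d\<close>.\<close>
  then have "shift w f [] = 0"
    by (rule span_vanishing_at) (use k(1) short in \<open>auto simp: S_def shift_def\<close>)
  then show ?thesis
    by (simp add: shift_def)
qed

section \<open>The series of a hidden Markov model\<close>

text \<open>Unlike \<open>hmm_map\<close>, this is not cut off at one length, so that two models can
  be compared on words of all lengths.\<close>

definition hmm_series ::
    "nat \<Rightarrow> complex mat \<Rightarrow> (nat \<Rightarrow> 'a \<Rightarrow> complex) \<Rightarrow> complex vec \<Rightarrow> 'a list \<Rightarrow> complex" where
  "hmm_series l A E x v =
     scalar_prod (vec l (\<lambda>_. 1)) (fold (\<lambda>a y. hmm_op l A E a *\<^sub>v y) v x)"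

text \<open>This is the row vector
  \<open>(1, \<dots>, 1) T\<^sub>a\<^sub>n \<dots> T\<^sub>a\<^sub>1\<close>, written as a column by
  means of transposes.\<close>

definition hmm_row ::
    "nat \<Rightarrow> complex mat \<Rightarrow> (nat \<Rightarrow> 'a \<Rightarrow> complex) \<Rightarrow> 'a list \<Rightarrow> complex vec" where
  "hmm_row l A E v =
     foldr (\<lambda>a r. transpose_mat (hmm_op l A E a) *\<^sub>v r) v (vec l (\<lambda>_. 1))"

lemma hmm_map_eq: "hmm_map \<Sigma> n l (A, E, x) = restrict (hmm_series l A E x) (words \<Sigma> n)"
  by (auto simp: hmm_map_def hmm_series_def restrict_def fun_eq_iff)

lemma hmm_op_carrier: "A \<in> carrier_mat l l \<Longrightarrow> hmm_op l A E a \<in> carrier_mat l l"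
  unfolding hmm_op_def by (intro mult_carrier_mat) auto

lemma hmm_row_carrier:
  assumes "A \<in> carrier_mat l l"
  shows "hmm_row l A E v \<in> carrier_vec l"
  by (induction v)
    (auto simp: hmm_row_def intro!: mult_mat_vec_carrier hmm_op_carrier[OF assms])

lemma fold_hmm_op_carrier:
  assumes "A \<in> carrier_mat l l" and "x \<in> carrier_vec l"
  shows "fold (\<lambda>a y. hmm_op l A E a *\<^sub>v y) v x \<in> carrier_vec l"
  using assms(2)
  by (induction v arbitrary: x) (auto intro!: mult_mat_vec_carrier hmm_op_carrier[OF assms(1)])

lemma hmm_series_append:
  "hmm_series l A E x (u @ v) =
   hmm_series l A E (fold (\<lambda>a y. hmm_op l A E a *\<^sub>v y) u x) v"
  by (simp add: hmm_series_def)

lemma hmm_series_Cons: "hmm_series l A E x (a # v) = hmm_series l A E (hmm_op l A E a *\<^sub>v x) v"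
  by (simp add: hmm_series_def)

text \<open>The initial vector enters only through the coefficients of \<open>l\<close> series that
  depend on \<open>A\<close> and \<open>E\<close> alone. This bounds the dimension of the space of
  shifts.\<close>

lemma hmm_series_eq_row:
  assumes A: "A \<in> carrier_mat l l" and "x \<in> carrier_vec l"
  shows "hmm_series l A E x v = (\<Sum>i<l. x $ i * hmm_row l A E v $ i)"
proof -
  have "hmm_series l A E x v = hmm_row l A E v \<bullet> x"
    using assms(2)
  proof (induction v arbitrary: x)
    case Nil
    then show ?case by (simp add: hmm_series_def hmm_row_def)
  next
    case (Cons a v)
    note T = hmm_op_carrier[OF A, of E a]
    have "hmm_series l A E x (a # v) = hmm_row l A E v \<bullet> (hmm_op l A E a *\<^sub>v x)"
      using Cons T by (simp add: hmm_series_Cons)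
    also have "\<dots> = (transpose_mat (hmm_op l A E a) *\<^sub>v hmm_row l A E v) \<bullet> x"
      using transpose_vec_mult_scalar[OF T Cons.prems hmm_row_carrier[OF A, of E v]] by simp
    finally show ?case by (simp add: hmm_row_def)
  qed
  then show ?thesis
    using assms(2) by (simp add: scalar_prod_def atLeast0LessThan mult.commute)
qed

text \<open>The row sums of \<open>A\<close> reduce \<open>(1, \<dots>, 1) T\<^sub>a\<close> to the
  column of \<open>E\<close> for the letter \<open>a\<close>; the row sums of \<open>E\<close> then
  make these columns add up to \<open>(1, \<dots>, 1)\<close>.\<close>

lemma sum_hmm_op:
  assumes "(A, E, x) \<in> hmm_params \<Sigma> l" and y: "y \<in> carrier_vec l"
  shows "(\<Sum>a\<in>\<Sigma>. vec l (\<lambda>_. 1) \<bullet> (hmm_op l A E a *\<^sub>v y)) = vec l (\<lambda>_. 1) \<bullet> y"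
proof -
  have A: "A \<in> carrier_mat l l" and rowA: "\<And>i. i < l \<Longrightarrow> (\<Sum>j<l. A $$ (i, j)) = 1"
    and rowE: "\<And>i. i < l \<Longrightarrow> (\<Sum>a\<in>\<Sigma>. E i a) = 1"
    using assms(1) by (auto simp: hmm_params_def)
  have "vec l (\<lambda>_. 1) \<bullet> (hmm_op l A E a *\<^sub>v y) = (\<Sum>j<l. E j a * y $ j)" for a
  proof -
    have "vec l (\<lambda>_. 1) \<bullet> (hmm_op l A E a *\<^sub>v y) = (\<Sum>i<l. \<Sum>j<l. A $$ (j, i) * E j a * y $ j)"
      using A y
      by (auto simp: hmm_op_def scalar_prod_def mat_diag_mult_right[of _ l l]
          atLeast0LessThan intro!: sum.cong)
    also have "\<dots> = (\<Sum>j<l. (\<Sum>i<l. A $$ (j, i)) * E j a * y $ j)"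
      by (subst sum.swap) (simp add: sum_distrib_right)
    finally show ?thesis by (simp add: rowA)
  qed
  then have "(\<Sum>a\<in>\<Sigma>. vec l (\<lambda>_. 1) \<bullet> (hmm_op l A E a *\<^sub>v y)) = (\<Sum>a\<in>\<Sigma>. \<Sum>j<l. E j a * y $ j)"
    by simp
  also have "\<dots> = (\<Sum>j<l. (\<Sum>a\<in>\<Sigma>. E j a) * y $ j)"
    by (subst sum.swap) (simp add: sum_distrib_right)
  also have "\<dots> = vec l (\<lambda>_. 1) \<bullet> y"
    using y by (simp add: rowE scalar_prod_def atLeast0LessThan)
  finally show ?thesis .
qed

lemma marginal_hmm_series:
  assumes "(A, E, x) \<in> hmm_params \<Sigma> l" and "y \<in> carrier_vec l"
  shows "marginal \<Sigma> (hmm_series l A E y) v = hmm_series l A E y v"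
proof -
  have "A \<in> carrier_mat l l"
    using assms(1) by (simp add: hmm_params_def)
  from sum_hmm_op[OF assms(1) fold_hmm_op_carrier[OF this assms(2)]]
  show ?thesis
    by (simp add: marginal_def hmm_series_def)
qed

lemma hmm_series_agree:
  assumes P: "(A, E, x) \<in> hmm_params \<Sigma> l" and Q: "(B, F, y) \<in> hmm_params \<Sigma> l"
    and agree: "\<And>w. w \<in> words \<Sigma> m \<Longrightarrow> hmm_series l A E x w = hmm_series l B F y w"
    and m: "2 * l \<le> Suc m" and w: "set w \<subseteq> \<Sigma>"
  shows "hmm_series l A E x w = hmm_series l B F y w"
proof -
  have A: "A \<in> carrier_mat l l" and x: "x \<in> carrier_vec l"
    and B: "B \<in> carrier_mat l l" and y: "y \<in> carrier_vec l"
    using P Q by (auto simp: hmm_params_def)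
  have le: "hmm_series l A E x w = hmm_series l B F y w"
    \<comment> \<open>Summing out last letters carries agreement from length \<open>m\<close> down
      to all shorter words.\<close>
    if "length w \<le> m" "set w \<subseteq> \<Sigma>" for w
    using that
  proof (induction "m - length w" arbitrary: w)
    case 0
    then show ?case by (simp add: agree words_def)
  next
    case (Suc k)
    have "marginal \<Sigma> (hmm_series l A E x) w = marginal \<Sigma> (hmm_series l B F y) w"
      unfolding marginal_def using Suc by (intro sum.cong) auto
    then show ?case
      by (simp add: marginal_hmm_series[OF P x] marginal_hmm_series[OF Q y])
  qed
  define g where "g C G i w = hmm_row l C G w $ i" for C and G :: "nat \<Rightarrow> 'a \<Rightarrow> complex" and i w
  \<comment> \<open>These at most \<open>2 * l\<close> series do not involve the initial vectors.
    Shifting by \<open>u\<close> only replaces each initial vector by its image under the operators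
    of \<open>u\<close>, so all shifts of the difference stay in the span of
    \<open>U\<close>.\<close>
  define U where "U = g A E ` {..<l} \<union> g B F ` {..<l}"
  have "card U \<le> card (g A E ` {..<l}) + card (g B F ` {..<l})"
    unfolding U_def by (rule card_Un_le)
  also have "\<dots> \<le> l + l"
    by (intro add_mono order.trans[OF card_image_le]) auto
  finally have card: "card U \<le> 2 * l" by simp
  have in_span: "hmm_series l C G z \<in> series.span U"
    if "C \<in> carrier_mat l l" "z \<in> carrier_vec l" "g C G ` {..<l} \<subseteq> U"
    for C z and G :: "nat \<Rightarrow> 'a \<Rightarrow> complex"
  proof -
    have "(\<Sum>i<k. f i) w = (\<Sum>i<k. f i w)" for k w and f :: "nat \<Rightarrow> 'a list \<Rightarrow> complex"
      by (induction k) simp_all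
    then have "hmm_series l C G z = (\<Sum>i<l. (\<lambda>w. z $ i * g C G i w))"
      using hmm_series_eq_row[OF that(1,2), of G] by (simp add: fun_eq_iff g_def)
    also have "\<dots> \<in> series.span U"
      using that(3) by (intro series.span_sum series.span_scale series.span_base) auto
    finally show ?thesis .
  qed
  have "(hmm_series l A E x - hmm_series l B F y) w = 0"
  proof (rule series_zero_if_zero_on_short_words[where U = U and d = "2 * l" and \<Sigma> = \<Sigma>])
    show "finite U" by (simp add: U_def)
    show "card U \<le> 2 * l" by (fact card)
    show "shift u (hmm_series l A E x - hmm_series l B F y) \<in> series.span U" for u
    proof -
      have "shift u (hmm_series l A E x - hmm_series l B F y) =
        hmm_series l A E (fold (\<lambda>a y. hmm_op l A E a *\<^sub>v y) u x) -
        hmm_series l B F (fold (\<lambda>a y. hmm_op l B F a *\<^sub>v y) u y)"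
        by (simp add: shift_def fun_eq_iff hmm_series_append)
      also have "\<dots> \<in> series.span U"
        by (intro series.span_diff in_span fold_hmm_op_carrier A B x y) (auto simp: U_def)
      finally show ?thesis .
    qed
    show "(hmm_series l A E x - hmm_series l B F y) v = 0"
      if "set v \<subseteq> \<Sigma>" "length v < 2 * l" for v
      using le[of v] that m by simp
  qed (fact w)
  then show ?thesis by simp
qed

theorem corollary5p3:
  fixes \<Sigma> :: "'a set" and l n :: nat and p :: "'a list \<Rightarrow> complex"
  assumes "finite \<Sigma>" and "l \<ge> 1" and "n \<ge> 2 * l"
  shows "restrict p (words \<Sigma> (n + 1)) \<in> hmm_map \<Sigma> (n + 1) l ` hmm_params \<Sigma> l \<longleftrightarrow>
    (\<forall>a\<in>\<Sigma>. (\<lambda>v\<in>words \<Sigma> n. p (a # v)) \<in> hmm_map \<Sigma> n l ` hmm_params \<Sigma> l) \<and>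
    (\<lambda>v\<in>words \<Sigma> n. marginal \<Sigma> p v) \<in> hmm_map \<Sigma> n l ` hmm_params \<Sigma> l"
    (is "?L \<longleftrightarrow> ?R1 \<and> ?R2")
proof -
  have restrict_in_image: "restrict q (words \<Sigma> k) \<in> hmm_map \<Sigma> k l ` hmm_params \<Sigma> l \<longleftrightarrow>
    (\<exists>A E x. (A, E, x) \<in> hmm_params \<Sigma> l \<and> (\<forall>v\<in>words \<Sigma> k. q v = hmm_series l A E x v))"
    for q :: "'a list \<Rightarrow> complex" and k
  proof -
    have "restrict q (words \<Sigma> k) = restrict r (words \<Sigma> k) \<longleftrightarrow> (\<forall>v\<in>words \<Sigma> k. q v = r v)" for r
      by (auto simp: restrict_def fun_eq_iff)
    then show ?thesis
      by (simp add: image_iff Bex_def hmm_map_eq)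
  qed
  \<comment> \<open>Splitting off a first letter moves the initial vector to
    \<open>T\<^sub>a x\<close>. This is again admissible, since no normalization of the initial
    vector is imposed.\<close>
  have params_step: "(A, E, hmm_op l A E a *\<^sub>v x) \<in> hmm_params \<Sigma> l"
    if "(A, E, x) \<in> hmm_params \<Sigma> l" for A E x a
    using that mult_mat_vec_carrier[OF hmm_op_carrier] by (auto simp: hmm_params_def)
  show ?thesis
  proof
    assume ?L
    then obtain A E x where P: "(A, E, x) \<in> hmm_params \<Sigma> l"
      and p: "\<And>u. u \<in> words \<Sigma> (n + 1) \<Longrightarrow> p u = hmm_series l A E x u"
      unfolding restrict_in_image by blast
    have x: "x \<in> carrier_vec l"
      using P by (simp add: hmm_params_def)
    have "?R1"
    proof
      fix a assume "a \<in> \<Sigma>"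
      then have "p (a # v) = hmm_series l A E (hmm_op l A E a *\<^sub>v x) v" if "v \<in> words \<Sigma> n" for v
        using p[of "a # v"] that by (simp add: words_def hmm_series_Cons)
      then show "(\<lambda>v\<in>words \<Sigma> n. p (a # v)) \<in> hmm_map \<Sigma> n l ` hmm_params \<Sigma> l"
        unfolding restrict_in_image using params_step[OF P] by blast
    qed
    moreover have "marginal \<Sigma> p v = hmm_series l A E x v" if "v \<in> words \<Sigma> n" for v
    proof -
      have "marginal \<Sigma> p v = marginal \<Sigma> (hmm_series l A E x) v"
        unfolding marginal_def using that p by (intro sum.cong) (auto simp: words_def)
      then show ?thesis by (simp add: marginal_hmm_series[OF P x])
    qed
    then have "?R2"
      unfolding restrict_in_image using P by blast
    ultimately show "?R1 \<and> ?R2" ..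
  next
    assume R: "?R1 \<and> ?R2"
    then obtain A E x where P: "(A, E, x) \<in> hmm_params \<Sigma> l"
      and marg: "\<And>v. v \<in> words \<Sigma> n \<Longrightarrow> marginal \<Sigma> p v = hmm_series l A E x v"
      unfolding restrict_in_image by blast
    obtain m where n: "n = Suc m"
      using assms by (cases n) auto
    have "p u = hmm_series l A E x u" if u: "u \<in> words \<Sigma> (n + 1)" for u
    proof -
      obtain a v where av: "u = a # v" "a \<in> \<Sigma>" "v \<in> words \<Sigma> n"
        using u by (cases u) (auto simp: words_def)
      then obtain B F y where Q: "(B, F, y) \<in> hmm_params \<Sigma> l"
        and pa: "\<And>v. v \<in> words \<Sigma> n \<Longrightarrow> p (a # v) = hmm_series l B F y v"
        using R unfolding restrict_in_image by blast
      have y: "y \<in> carrier_vec l"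
        using Q by (simp add: hmm_params_def)
      \<comment> \<open>Both sides equal the sum of \<open>p (a # w @ [b])\<close> over the letters
        \<open>b\<close>. The letters \<open>a\<close> and \<open>b\<close> together exceed
        \<open>w\<close> by two, hence the length \<open>m = n - 1\<close> here.\<close>
      have "hmm_series l B F y w = hmm_series l A E (hmm_op l A E a *\<^sub>v x) w"
        if w: "w \<in> words \<Sigma> m" for w
      proof -
        have "hmm_series l B F y w = marginal \<Sigma> (hmm_series l B F y) w"
          by (simp add: marginal_hmm_series[OF Q y])
        also have "\<dots> = marginal \<Sigma> p (a # w)"
          unfolding marginal_def using w n pa by (intro sum.cong) (auto simp: words_def)
        also have "\<dots> = hmm_series l A E x (a # w)"
          using w n av(2) by (intro marg) (simp add: words_def)
        finally show ?thesis by (simp add: hmm_series_Cons)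
      qed
      \<comment> \<open>Agreement passes from length \<open>m\<close> up to length \<open>n\<close>;
        the required bound \<open>2 * l \<le> Suc m\<close> is exactly
        \<open>n \<ge> 2 * l\<close>.\<close>
      from hmm_series_agree[OF Q params_step[OF P] this, where w = v]
      have "hmm_series l B F y v = hmm_series l A E x (a # v)"
        using assms(3) n av(3) by (simp add: words_def hmm_series_Cons)
      then show ?thesis
        using pa[OF av(3)] av(1) by simp
    qed
    then show ?L
      unfolding restrict_in_image using P by blast
  qed
qed

end
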